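(* Let $d\geq 1$ and let $T_1,\dots,T_d$ be trees, each with at least one edge, such that $\Delta(T_i)$ is even for all $i\in\{1,\dots,d\}$. Let $G:=T_1\square T_2\square\cdots\square T_d$ be their cartesian product, and let $G^2$ be the square of $G$. Then $$\chi(G^2)=1+\sum_{i=1}^d \Delta(T_i).$$
   Context: Graphs are finite and simple. $\Delta(G)$ denotes the maximum degree of a graph $G$. A colouring of a graph $G$ is a function $c:V(G)\to\mathbb{Z}$ such that $c(v)\neq c(w)$ for every edge $vw$ of $G$; $\chi(G)$ is the chromatic number, i.e. the minimum number of distinct colours used in a colouring of $G$. The square $G^2$ of $G$ is the graph with vertex set $V(G)$ in which two distinct vertices are adjacent whenever they are adjacent in $G$ or have a common neighbour in $G$. The cartesian product $G_1\square\cdots\square G_d$ of graphs $G_1,\dots,G_d$ is the graph with vertex set $\{(v_1,\dots,v_d): v_i\in V(G_i)\}$, where $v=(v_1,\dots,v_d)$ and $w=(w_1,\dots,w_d)$ are adjacent whenever for some $i\in\{1,\dots,d\}$ we have $v_iw_i\in E(G_i)$ and $v_j=w_j$ for all $j\neq i$. *)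

theory Defs
  imports "HOL-Library.FuncSet" "Graph_Theory.Digraph_Component"
begin

text \<open>
  A finite simple graph is a \<^locale>\<open>pair_graph\<close>: each undirected edge \<open>uv\<close> is
  represented by the two arcs \<open>(u, v)\<close> and \<open>(v, u)\<close>.
\<close>

definition max_degree :: "'a pair_pre_digraph \<Rightarrow> nat" where
  "max_degree G = Max (out_degree (with_proj G) ` pverts G)"

text \<open>
  The library's \<^const>\<open>forest\<close> and \<^const>\<open>tree\<close> are unsuitable here: for them the
  two arcs representing an edge already form a cycle. The cycles of an undirected graph are
  the directed cycles of length at least 3 of its symmetric representation.
  Note that \<^const>\<open>connected\<close> includes non-emptiness.
\<close>

definition undirected_tree :: "'a pair_pre_digraph \<Rightarrow> bool" where
  "undirected_tree G \<longleftrightarrow> pair_graph G \<and> connected (with_proj G) \<and>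
     \<not> (\<exists>p. pre_digraph.cycle (with_proj G) p \<and> length p \<ge> 3)"

text \<open>Vertices of the product are tuples, encoded as extensional functions on the index set.\<close>

definition cartesian_product :: "'i set \<Rightarrow> ('i \<Rightarrow> 'a pair_pre_digraph) \<Rightarrow> ('i \<Rightarrow> 'a) pair_pre_digraph" where
  "cartesian_product I T =
     \<lparr> pverts = (\<Pi>\<^sub>E i\<in>I. pverts (T i)),
       parcs = {(v, w). v \<in> (\<Pi>\<^sub>E i\<in>I. pverts (T i)) \<and> w \<in> (\<Pi>\<^sub>E i\<in>I. pverts (T i)) \<and>
                  (\<exists>i\<in>I. (v i, w i) \<in> parcs (T i) \<and> (\<forall>j\<in>I. j \<noteq> i \<longrightarrow> v j = w j))} \<rparr>"

definition graph_square :: "'a pair_pre_digraph \<Rightarrow> 'a pair_pre_digraph" where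
  "graph_square G =
     \<lparr> pverts = pverts G,
       parcs = {(v, w). v \<in> pverts G \<and> w \<in> pverts G \<and> v \<noteq> w \<and>
                  ((v, w) \<in> parcs G \<or> (\<exists>u\<in>pverts G. (v, u) \<in> parcs G \<and> (w, u) \<in> parcs G))} \<rparr>"

definition colouring :: "'a pair_pre_digraph \<Rightarrow> ('a \<Rightarrow> int) \<Rightarrow> bool" where
  "colouring G c \<longleftrightarrow> (\<forall>(v, w)\<in>parcs G. c v \<noteq> c w)"

text \<open>
  The values of a colouring outside the vertex set are irrelevant. The definition is meaningful
  for finite loopless graphs, where a colouring exists and the number of colours is finite.
\<close>

definition chromatic_number :: "'a pair_pre_digraph \<Rightarrow> nat" where
  "chromatic_number G = (LEAST k. \<exists>c. colouring G c \<and> card (c ` pverts G) = k)"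

lemma pair_graph_graph_square:
  assumes "pair_graph G"
  shows "pair_graph (graph_square G)"
proof -
  interpret pair_graph G by fact
  have s: "(v, u) \<in> parcs G" if "(u, v) \<in> parcs G" for u v
    using that by (rule arcs_symmetric)
  have "finite (pverts G \<times> pverts G)"
    using pair_finite_verts by blast
  then have "finite (parcs (graph_square G))"
    by (rule rev_finite_subset) (auto simp: graph_square_def)
  then show ?thesis
    using pair_finite_verts s
    by unfold_locales (auto simp: graph_square_def symmetric_def intro!: symI)
qed

lemma pair_graph_cartesian_product:
  assumes I: "finite I" and T: "\<And>i. i \<in> I \<Longrightarrow> pair_graph (T i)"
  shows "pair_graph (cartesian_product I T)"
proof -
  have s: "(v, u) \<in> parcs (T i)" if "i \<in> I" "(u, v) \<in> parcs (T i)" for i u v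
    using pair_sym_digraph.arcs_symmetric[of "T i"] T[OF that(1)] that(2)
    by (auto simp: pair_graph_def pair_pseudo_graph_def)
  have l: "u \<noteq> v" if "i \<in> I" "(u, v) \<in> parcs (T i)" for i u v
    using pair_loopfree_digraph.no_loops'[of "T i"] T[OF that(1)] that(2)
    by (auto simp: pair_graph_def pair_digraph_def)
  have f: "finite (\<Pi>\<^sub>E i\<in>I. pverts (T i))"
    using I T by (intro finite_PiE) (auto simp: pair_graph_def pair_digraph_def
        pair_fin_digraph_def pair_fin_digraph_axioms_def)
  then have "finite ((\<Pi>\<^sub>E i\<in>I. pverts (T i)) \<times> (\<Pi>\<^sub>E i\<in>I. pverts (T i)))"
    by blast
  then have g: "finite (parcs (cartesian_product I T))"
    by (rule rev_finite_subset) (auto simp: cartesian_product_def)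
  have sy: "sym (parcs (cartesian_product I T))"
    by (rule symI) (auto simp: cartesian_product_def dest: s intro: sym)
  show ?thesis
  proof
    show "symmetric (with_proj (cartesian_product I T))"
      using sy by (simp add: symmetric_def)
  qed (use f g l in \<open>auto simp: cartesian_product_def\<close>, blast+)
qed

end

theory Submission
  imports Defs
begin

text \<open>
  In the square of any graph a vertex and its neighbours are pairwise adjacent. In the product,
  degrees add up over the coordinates (\<open>card_nbrs_cartesian_product\<close>), so the tuple that
  has a vertex of maximum degree in every coordinate gives a clique with
  \<open>1 + (\<Sum>i. \<Delta>(T\<^sub>i))\<close> elements. This is the lower bound.

  For the upper bound write \<open>\<Delta>(T\<^sub>i) = 2 k\<^sub>i\<close> and \<open>m = (\<Sum>i. k\<^sub>i)\<close>, and divide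
  \<open>{1..m}\<close> into disjoint blocks \<open>S\<^sub>i\<close> of size \<open>k\<^sub>i\<close>. The set
  \<open>D\<^sub>i = S\<^sub>i \<union> -S\<^sub>i\<close> is symmetric and has exactly \<open>\<Delta>(T\<^sub>i)\<close> elements. This is
  enough to label the vertices of the tree \<open>T\<^sub>i\<close> by integers in such a way that
  the differences along the edges at any vertex are distinct elements of \<open>D\<^sub>i\<close>
  (\<open>tree_difference_labelling\<close>): the tree is labelled outwards from a root, and a vertex that
  receives a new neighbour still has an unused difference.

  A vertex of the product is coloured by the sum of the labels of its coordinates, modulo
  \<open>2 m + 1\<close> (\<open>colouring_square_product\<close>). A step along an edge changes this sum by an element
  \<open>s\<close> of some \<open>D\<^sub>i\<close>. Two different steps from the same vertex give different changes
  \<open>s \<noteq> t\<close>: in the same coordinate by the choice of the labelling, and in different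
  coordinates because the blocks are disjoint, whence \<open>\<bar>s\<bar> \<noteq> \<bar>t\<bar>\<close>. As all changes lie between
  \<open>-m\<close> and \<open>m\<close> and are not \<open>0\<close>, neither \<open>s\<close> nor \<open>s - t\<close> is divisible by \<open>2 m + 1\<close>.
\<close>

section \<open>Neighbourhoods and degrees\<close>

definition nbrs :: "'a pair_pre_digraph \<Rightarrow> 'a \<Rightarrow> 'a set" where
  "nbrs G v = {w. (v, w) \<in> parcs G}"

lemma out_degree_eq_card_nbrs: "out_degree (with_proj G) v = card (nbrs G v)"
proof -
  have "out_arcs (with_proj G) v = Pair v ` nbrs G v"
    by (auto simp: out_arcs_def nbrs_def)
  then show ?thesis
    by (simp add: out_degree_def card_image inj_on_def)
qed

lemma (in pair_graph) finite_nbrs: "finite (nbrs G v)"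
  by (rule finite_subset[OF _ pair_finite_verts]) (auto simp: nbrs_def dest: in_arcsD2)

lemma (in pair_graph) card_nbrs_le: "v \<in> pverts G \<Longrightarrow> card (nbrs G v) \<le> max_degree G"
  unfolding max_degree_def out_degree_eq_card_nbrs
  using pair_finite_verts by simp

lemma (in pair_graph) max_degree_attained:
  assumes "pverts G \<noteq> {}"
  obtains v where "v \<in> pverts G" "card (nbrs G v) = max_degree G"
proof -
  have "Max (out_degree (with_proj G) ` pverts G) \<in> out_degree (with_proj G) ` pverts G"
    using assms pair_finite_verts by (intro Max_in) auto
  then show ?thesis
    using that by (auto simp: max_degree_def out_degree_eq_card_nbrs)
qed

section \<open>Locally injective labellings of trees\<close>

text \<open>
  The set \<open>X\<close> is the part of the graph labelled so far. Injectivity on a neighbourhood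
  says that the differences along the edges at a vertex are distinct.
\<close>

definition difference_labelling :: "int set \<Rightarrow> 'a pair_pre_digraph \<Rightarrow> 'a set \<Rightarrow> ('a \<Rightarrow> int) \<Rightarrow> bool"
  where "difference_labelling D G X c \<longleftrightarrow>
    (\<forall>u\<in>X. \<forall>v \<in> nbrs G u \<inter> X. c v - c u \<in> D) \<and> (\<forall>u\<in>X. inj_on c (nbrs G u \<inter> X))"

text \<open>
  This is connectedness of the subgraph induced on \<open>X\<close>, expressed by paths of the whole graph,
  so that the cycles built from such paths are cycles of the whole graph.
\<close>

definition (in pair_graph) internally_connected :: "'a set \<Rightarrow> bool" where
  "internally_connected X \<longleftrightarrow>
     (\<forall>x\<in>X. \<forall>y\<in>X. \<exists>p. apath x p y \<and> set (awalk_verts x p) \<subseteq> X)"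

lemma (in pair_graph) internally_connected_insert:
  assumes X: "internally_connected X" and u: "u \<in> X" and uw: "(u, w) \<in> parcs G" and w: "w \<notin> X"
  shows "internally_connected (insert w X)"
proof -
  have wu: "(w, u) \<in> parcs G" using uw by (rule arcs_symmetric)
  have from_w: "\<exists>p. apath w p y \<and> set (awalk_verts w p) \<subseteq> insert w X" if y: "y \<in> X" for y
  proof -
    obtain p where p: "apath u p y" "set (awalk_verts u p) \<subseteq> X"
      using X u y unfolding internally_connected_def by blast
    then have "apath w ((w, u) # p) y"
      using wu w by (auto simp: apath_Cons_iff)
    with p(2) show ?thesis by (intro exI[of _ "(w, u) # p"]) auto
  qed
  have to_w: "\<exists>p. apath y p w \<and> set (awalk_verts y p) \<subseteq> insert w X" if y: "y \<in> X" for y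
  proof -
    obtain p where p: "apath w p y" "set (awalk_verts w p) \<subseteq> insert w X"
      using from_w y by blast
    then have "awalk_verts y (rev_path p) = rev (awalk_verts w p)"
      by (intro awalk_verts_rev_path) (auto simp: apath_def)
    with p show ?thesis by (intro exI[of _ "rev_path p"]) auto
  qed
  have w_w: "\<exists>p. apath w p w \<and> set (awalk_verts w p) \<subseteq> insert w X"
    using in_arcsD2[OF uw] by (intro exI[of _ "[]"]) (auto simp: apath_Nil_iff)
  show ?thesis
    unfolding internally_connected_def
  proof (intro ballI)
    fix x y assume "x \<in> insert w X" "y \<in> insert w X"
    then consider "x = w" "y = w" | "x = w" "y \<in> X" | "x \<in> X" "y = w" | "x \<in> X" "y \<in> X" by blast
    then show "\<exists>p. apath x p y \<and> set (awalk_verts x p) \<subseteq> insert w X"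
    proof cases
      case 4
      then show ?thesis using X unfolding internally_connected_def by blast
    qed (use from_w to_w w_w in blast)+
  qed
qed

text \<open>
  Two neighbours of \<open>w\<close> in \<open>X\<close> would be joined by a path inside \<open>X\<close>, and this path would
  close up through \<open>w\<close> to a cycle. Hence a new vertex of a growing subtree is constrained
  by one labelled vertex only.
\<close>

lemma (in pair_graph) unique_attachment:
  assumes acyclic: "\<not> (\<exists>p. cycle p \<and> length p \<ge> 3)"
    and X: "internally_connected X" and w: "w \<notin> X"
    and u: "u \<in> nbrs G w \<inter> X" and v: "v \<in> nbrs G w \<inter> X"
  shows "u = v"
proof (rule ccontr)
  assume "u \<noteq> v"
  obtain p where p: "apath u p v" "set (awalk_verts u p) \<subseteq> X"
    using X u v unfolding internally_connected_def by blast
  have "p \<noteq> []"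
    using \<open>u \<noteq> v\<close> p(1) by (auto simp: apath_Nil_iff)
  have "(w, u) \<in> parcs G" "(w, v) \<in> parcs G"
    using u v by (auto simp: nbrs_def)
  have vw: "(v, w) \<in> parcs G"
    using \<open>(w, v) \<in> parcs G\<close> by (rule arcs_symmetric)
  have "awalk u p v" "distinct (awalk_verts u p)"
    using p(1) by (auto simp: apath_def)
  have "awalk v [(v, w)] w"
    using vw by (auto simp: awalk_simps dest: in_arcsD2)
  with \<open>awalk u p v\<close> have upw: "awalk u (p @ [(v, w)]) w"
    by (rule awalk_appendI)
  then have walk: "awalk w ((w, u) # p @ [(v, w)]) w"
    using \<open>(w, u) \<in> parcs G\<close> unfolding awalk_Cons_iff by simp
  have "awalk_verts u (p @ [(v, w)]) = awalk_verts u p @ [w]"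
    using awalk_verts_append[OF upw] \<open>awalk u p v\<close> by auto
  then have "distinct (tl (awalk_verts w ((w, u) # p @ [(v, w)])))"
    using \<open>distinct (awalk_verts u p)\<close> p(2) w by auto
  with walk have "cycle ((w, u) # p @ [(v, w)])"
    unfolding cycle_def by blast
  moreover have "length ((w, u) # p @ [(v, w)]) \<ge> 3"
    using \<open>p \<noteq> []\<close> by (cases p) auto
  ultimately show False using acyclic by blast
qed

lemma (in pair_graph) arc_leaving:
  assumes conn: "connected (with_proj G)"
    and X: "X \<subseteq> pverts G" "X \<noteq> {}" "X \<noteq> pverts G"
  obtains u w where "u \<in> X" "w \<in> pverts G - X" "(u, w) \<in> parcs G"
proof -
  obtain x y where x: "x \<in> X" and y: "y \<in> pverts G - X" using X by blast
  have "x \<rightarrow>\<^sup>*\<^bsub>mk_symmetric G\<^esub> y"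
    using conn x y X(1) unfolding connected_def strongly_connected_def by auto
  then have "x \<rightarrow>\<^sup>*\<^bsub>G\<^esub> y"
    using reachable_mk_symmetric_eq by (simp add: pair_sym_arcs)
  then have "y \<in> X \<or> (\<exists>u\<in>X. \<exists>w\<in>pverts G - X. (u, w) \<in> parcs G)"
  proof (induction rule: reachable_induct)
    case (step a b)
    then show ?case using in_arcsD2 by auto
  qed (use x in auto)
  then show ?thesis using that y by blast
qed

text \<open>
  At most \<open>\<Delta> - 1\<close> neighbours of \<open>u\<close> are labelled while \<open>w\<close> is not, so some \<open>x \<in> D\<close> is not
  yet the difference along an edge at \<open>u\<close>, and \<open>w\<close> receives the label of \<open>u\<close> plus \<open>x\<close>.
  Seen from \<open>w\<close> the difference is \<open>-x\<close>, which is why \<open>D\<close> has to be symmetric.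
\<close>

lemma (in pair_graph) difference_labelling_insert:
  assumes acyclic: "\<not> (\<exists>p. cycle p \<and> length p \<ge> 3)"
    and D: "finite D" "card D = max_degree G" "\<And>x. x \<in> D \<Longrightarrow> -x \<in> D"
    and X: "X \<subseteq> pverts G" "internally_connected X"
    and c: "difference_labelling D G X c"
    and u: "u \<in> X" and uw: "(u, w) \<in> parcs G" and w: "w \<notin> X"
  shows "\<exists>c. difference_labelling D G (insert w X) c"
proof -
  have wu: "(w, u) \<in> parcs G" using uw by (rule arcs_symmetric)
  have "nbrs G u \<inter> X \<subset> nbrs G u" using uw w by (auto simp: nbrs_def)
  then have "card (nbrs G u \<inter> X) < card (nbrs G u)"
    by (intro psubset_card_mono finite_nbrs)
  also have "\<dots> \<le> card D" using card_nbrs_le u X(1) D(2) by auto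
  finally have "card ((\<lambda>v. c v - c u) ` (nbrs G u \<inter> X)) < card D"
    using card_image_le[of "nbrs G u \<inter> X" "\<lambda>v. c v - c u"] finite_nbrs[of u] by fastforce
  then have "\<not> D \<subseteq> (\<lambda>v. c v - c u) ` (nbrs G u \<inter> X)"
    using card_mono[of "(\<lambda>v. c v - c u) ` (nbrs G u \<inter> X)" D] finite_nbrs[of u] by fastforce
  then obtain x where x: "x \<in> D" "x \<notin> (\<lambda>v. c v - c u) ` (nbrs G u \<inter> X)" by blast
  define c' where "c' = c(w := c u + x)"
  have fresh: "c v \<noteq> c u + x" if "v \<in> nbrs G u \<inter> X" for v
    using x(2) that by force
  have c'_X: "c' v = c v" if "v \<in> X" for v using that w by (auto simp: c'_def)
  have attach: "nbrs G w \<inter> insert w X = {u}"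
  proof -
    have "u \<in> nbrs G w \<inter> X" using wu u by (simp add: nbrs_def)
    moreover have "w \<notin> nbrs G w" using no_loops'[of w w] by (auto simp: nbrs_def)
    ultimately show ?thesis using unique_attachment[OF acyclic X(2) w] by blast
  qed
  have far: "nbrs G v \<inter> insert w X = nbrs G v \<inter> X" if "v \<in> X" "v \<noteq> u" for v
    using attach that arcs_symmetric[of v w] by (auto simp: nbrs_def)
  have near: "nbrs G u \<inter> insert w X = insert w (nbrs G u \<inter> X)"
    using uw by (auto simp: nbrs_def)
  have c1: "c v - c z \<in> D" if "z \<in> X" "v \<in> nbrs G z \<inter> X" for z v
    using c that unfolding difference_labelling_def by blast
  have c2: "inj_on c (nbrs G z \<inter> X)" if "z \<in> X" for z
    using c that unfolding difference_labelling_def by blast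
  have c2': "inj_on c' (nbrs G z \<inter> X)" if "z \<in> X" for z
    using c2[OF that] by (rule inj_on_cong[THEN iffD1, rotated]) (simp add: c'_X)
  have "c' v - c' z \<in> D" if z: "z \<in> insert w X" and v: "v \<in> nbrs G z \<inter> insert w X" for z v
  proof -
    \<comment> \<open>The only new edge is the one between \<open>u\<close> and \<open>w\<close>.\<close>
    consider "z = w" | "z = u" "v = w" | "z \<in> X" "v \<in> nbrs G z \<inter> X"
      using z v far near by blast
    then show ?thesis
    proof cases
      case 1
      then have "v = u" using v attach by blast
      then show ?thesis using 1 x(1) D(3) c'_X[OF u] by (simp add: c'_def)
    next
      case 2
      then show ?thesis using x(1) c'_X[OF u] by (simp add: c'_def)
    next
      case 3
      then show ?thesis using c1 c'_X by auto
    qed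
  qed
  moreover have "inj_on c' (nbrs G z \<inter> insert w X)" if z: "z \<in> insert w X" for z
  proof -
    consider "z = w" | "z = u" | "z \<in> X" "z \<noteq> u" using z by blast
    then show ?thesis
    proof cases
      case 1
      then show ?thesis using attach by simp
    next
      case 2
      have "c' w \<notin> c' ` (nbrs G u \<inter> X)"
      proof
        assume "c' w \<in> c' ` (nbrs G u \<inter> X)"
        then obtain v where "v \<in> nbrs G u \<inter> X" "c' w = c' v" by blast
        then show False using fresh[of v] c'_X[of v] by (simp add: c'_def)
      qed
      then show ?thesis
        unfolding 2 near using c2'[OF u] by (auto simp: inj_on_insert)
    next
      case 3
      then show ?thesis using far c2' by simp
    qed
  qed
  ultimately show ?thesis unfolding difference_labelling_def by blast
qed

text \<open>
  A maximal connected vertex set that can be labelled is the whole vertex set, since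
  otherwise an arc leaving the set allows to label one more vertex.
\<close>

lemma tree_difference_labelling:
  assumes tree: "undirected_tree T"
    and D: "finite D" "card D = max_degree T" "\<And>x. x \<in> D \<Longrightarrow> -x \<in> D"
  obtains c where "difference_labelling D T (pverts T) c"
proof -
  interpret pair_graph T using tree by (simp add: undirected_tree_def)
  have conn: "connected (with_proj T)" and acyclic: "\<not> (\<exists>p. cycle p \<and> length p \<ge> 3)"
    using tree by (auto simp: undirected_tree_def)
  define A where "A = {X. X \<subseteq> pverts T \<and> X \<noteq> {} \<and> internally_connected X
                          \<and> (\<exists>c. difference_labelling D T X c)}"
  have "finite A"
    by (rule finite_subset[of _ "Pow (pverts T)"]) (auto simp: A_def pair_finite_verts)
  moreover obtain r where r: "r \<in> pverts T"
    using conn by (auto simp: connected_def strongly_connected_def)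
  have "{r} \<in> A"
  proof -
    have "apath r [] r" using r by (simp add: apath_Nil_iff)
    then have "internally_connected {r}"
      unfolding internally_connected_def by (auto intro!: exI[of _ "[]"])
    moreover have "nbrs T r \<inter> {r} = {}" using no_loops'[of r r] by (auto simp: nbrs_def)
    then have "difference_labelling D T {r} (\<lambda>_. 0)"
      by (simp add: difference_labelling_def)
    ultimately show ?thesis using r by (auto simp: A_def)
  qed
  ultimately obtain X where X: "X \<in> A" "\<And>Y. Y \<in> A \<Longrightarrow> X \<subseteq> Y \<Longrightarrow> X = Y"
    using finite_has_maximal[of A] by blast
  then obtain c where c: "X \<subseteq> pverts T" "X \<noteq> {}" "internally_connected X"
    "difference_labelling D T X c" by (auto simp: A_def)
  have "X = pverts T"
  proof (rule ccontr)
    assume "X \<noteq> pverts T"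
    then obtain u w where uw: "u \<in> X" "w \<in> pverts T - X" "(u, w) \<in> parcs T"
      using arc_leaving[OF conn c(1,2)] by blast
    then have "insert w X \<in> A"
      using difference_labelling_insert[OF acyclic D c(1,3,4) uw(1,3)]
        internally_connected_insert[OF c(3) uw(1,3)] c(1) by (auto simp: A_def)
    then show False using X(2)[of "insert w X"] uw(2) by blast
  qed
  then show ?thesis using c(4) that by blast
qed

section \<open>Cliques and the chromatic number\<close>

text \<open>
  The number of colours is counted as the size of the image, so a colouring with at most \<open>n\<close>
  colours uses exactly \<open>n\<close> once a clique with \<open>n\<close> elements is present.
\<close>

lemma chromatic_number_eqI:
  assumes fin: "finite (pverts G)"
    and K: "K \<subseteq> pverts G" "card K = n"
      "\<And>v w. v \<in> K \<Longrightarrow> w \<in> K \<Longrightarrow> v \<noteq> w \<Longrightarrow> (v, w) \<in> parcs G"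
    and c: "colouring G c" "card (c ` pverts G) \<le> n"
  shows "chromatic_number G = n"
proof -
  have lower: "n \<le> card (b ` pverts G)" if "colouring G b" for b
  proof -
    have "inj_on b K" using K(3) that by (force simp: inj_on_def colouring_def)
    then have "n = card (b ` K)" using K(2) by (simp add: card_image)
    also have "\<dots> \<le> card (b ` pverts G)" using fin K(1) by (intro card_mono) auto
    finally show ?thesis .
  qed
  have "card (c ` pverts G) = n" using lower[OF c(1)] c(2) by simp
  then show ?thesis
    unfolding chromatic_number_def using c(1) lower by (intro Least_equality) auto
qed

lemma closed_nbhd_clique_square:
  assumes "pair_graph G" and v: "v \<in> pverts G"
    and x: "x \<in> insert v (nbrs G v)" and y: "y \<in> insert v (nbrs G v)" and "x \<noteq> y"
  shows "(x, y) \<in> parcs (graph_square G)"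
proof -
  interpret pair_graph G by fact
  have "x \<in> pverts G" "y \<in> pverts G" using x y v by (auto simp: nbrs_def dest: in_arcsD2)
  moreover have "(x, v) \<in> parcs G" if "x \<noteq> v" using x that by (auto simp: nbrs_def intro: arcs_symmetric)
  moreover have "(y, v) \<in> parcs G" if "y \<noteq> v" using y that by (auto simp: nbrs_def intro: arcs_symmetric)
  ultimately show ?thesis
    using v \<open>x \<noteq> y\<close> arcs_symmetric by (auto simp: graph_square_def)
qed

section \<open>Cartesian products\<close>

lemma nbrs_cartesian_product:
  assumes wf: "\<And>i. i \<in> I \<Longrightarrow> pair_graph (T i)" and v: "v \<in> pverts (cartesian_product I T)"
  shows "nbrs (cartesian_product I T) v = (\<Union>i\<in>I. (\<lambda>x. v(i := x)) ` nbrs (T i) (v i))"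
    (is "?L = ?R")
proof
  show "?R \<subseteq> ?L"
  proof
    fix w assume "w \<in> ?R"
    then obtain i x where i: "i \<in> I" "(v i, x) \<in> parcs (T i)" "w = v(i := x)"
      by (auto simp: nbrs_def)
    interpret pair_graph "T i" using wf i(1) .
    have "w \<in> (\<Pi>\<^sub>E i\<in>I. pverts (T i))"
      using v i in_arcsD2[OF i(2)] by (auto simp: cartesian_product_def PiE_iff extensional_def)
    then show "w \<in> ?L" using i v by (auto simp: nbrs_def cartesian_product_def)
  qed
  show "?L \<subseteq> ?R"
  proof
    fix w assume "w \<in> ?L"
    then obtain i where i: "i \<in> I" "(v i, w i) \<in> parcs (T i)" "\<forall>j\<in>I. j \<noteq> i \<longrightarrow> v j = w j"
      "w \<in> (\<Pi>\<^sub>E i\<in>I. pverts (T i))" by (auto simp: nbrs_def cartesian_product_def)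
    have "w = v(i := w i)"
    proof (rule ext)
      fix j show "w j = (v(i := w i)) j"
        using i v by (cases "j \<in> I") (auto simp: cartesian_product_def PiE_iff extensional_def)
    qed
    then show "w \<in> ?R" using i by (auto simp: nbrs_def)
  qed
qed

lemma card_nbrs_cartesian_product:
  assumes I: "finite I" and wf: "\<And>i. i \<in> I \<Longrightarrow> pair_graph (T i)"
    and v: "v \<in> pverts (cartesian_product I T)"
  shows "card (nbrs (cartesian_product I T) v) = (\<Sum>i\<in>I. card (nbrs (T i) (v i)))"
proof -
  have loop: "v i \<notin> nbrs (T i) (v i)" if "i \<in> I" for i
  proof -
    interpret pair_graph "T i" using wf that .
    show ?thesis using no_loops' by (auto simp: nbrs_def)
  qed
  have nbhd: "nbrs (cartesian_product I T) v = (\<Union>i\<in>I. (\<lambda>x. v(i := x)) ` nbrs (T i) (v i))"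
    using wf v by (rule nbrs_cartesian_product)
  have "card (nbrs (cartesian_product I T) v)
      = (\<Sum>i\<in>I. card ((\<lambda>x. v(i := x)) ` nbrs (T i) (v i)))"
    unfolding nbhd
  proof (rule card_UN_disjoint[OF I])
    show "\<forall>i\<in>I. finite ((\<lambda>x. v(i := x)) ` nbrs (T i) (v i))"
      using wf by (auto intro: pair_graph.finite_nbrs)
    show "\<forall>i\<in>I. \<forall>j\<in>I. i \<noteq> j \<longrightarrow>
      (\<lambda>x. v(i := x)) ` nbrs (T i) (v i) \<inter> (\<lambda>x. v(j := x)) ` nbrs (T j) (v j) = {}"
    proof (intro ballI impI equals0I)
      fix i j w assume ij: "i \<in> I" "j \<in> I" "i \<noteq> j"
        and "w \<in> (\<lambda>x. v(i := x)) ` nbrs (T i) (v i) \<inter> (\<lambda>x. v(j := x)) ` nbrs (T j) (v j)"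
      then obtain x y where "x \<in> nbrs (T i) (v i)" "v(i := x) = v(j := y)" by blast
      then show False using loop[OF ij(1)] ij(3) fun_upd_apply[of v i x i] by auto
    qed
  qed
  also have "\<dots> = (\<Sum>i\<in>I. card (nbrs (T i) (v i)))"
    by (intro sum.cong refl card_image) (auto simp: inj_on_def dest: fun_upd_eqD)
  finally show ?thesis .
qed

section \<open>Colouring the square of a product\<close>

text \<open>
  The blocks are consecutive intervals: each new index takes the numbers directly above those
  already used.
\<close>

lemma disjoint_blocks:
  fixes k :: "'i \<Rightarrow> nat"
  assumes "finite I"
  obtains S :: "'i \<Rightarrow> int set" where
    "\<And>i. i \<in> I \<Longrightarrow> S i \<subseteq> {1..int (\<Sum>i\<in>I. k i)}" "\<And>i. i \<in> I \<Longrightarrow> card (S i) = k i"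
    "disjoint_family_on S I"
proof -
  have "\<exists>S :: 'i \<Rightarrow> int set. (\<forall>i\<in>I. S i \<subseteq> {1..int (\<Sum>i\<in>I. k i)} \<and> card (S i) = k i)
      \<and> disjoint_family_on S I"
    using assms
  proof (induction I)
    case empty
    then show ?case by (simp add: disjoint_family_on_def)
  next
    case (insert i I)
    define m where "m = int (\<Sum>i\<in>I. k i)"
    obtain S :: "'i \<Rightarrow> int set" where S: "\<forall>i\<in>I. S i \<subseteq> {1..m} \<and> card (S i) = k i" "disjoint_family_on S I"
      using insert.IH unfolding m_def by blast
    have m: "int (\<Sum>i\<in>insert i I. k i) = m + int (k i)" "m \<ge> 0"
      using insert.hyps by (auto simp: m_def sum_nonneg)
    have below: "x \<le> m" "x \<ge> 1" if "j \<in> I" "x \<in> S j" for j x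
      using S(1) that by force+
    have ne: "j \<noteq> i" if "j \<in> I" for j using insert.hyps that by blast
    let ?B = "{m + 1..m + int (k i)}"
    have "S j \<subseteq> {1..m + int (k i)}" "S j \<inter> ?B = {}" "?B \<inter> S j = {}" if "j \<in> I" for j
      using below[OF that] by force+
    then have "\<forall>j\<in>insert i I. (S(i := ?B)) j \<subseteq> {1..m + int (k i)} \<and> card ((S(i := ?B)) j) = k j"
      and "disjoint_family_on (S(i := ?B)) (insert i I)"
      using S m(2) ne unfolding disjoint_family_on_def by auto
    then show ?case unfolding m(1) by blast
  qed
  then show ?thesis using that by blast
qed

text \<open>
  Of two vertices adjacent in the square, either one is reached from the other by a single step,
  or both are reached from a common vertex by two different steps. In the first case the sums of labels differ by at most \<open>m\<close> in
  absolute value, in the second by at most \<open>2 * m\<close>, so distinct sums remain distinct modulo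
  \<open>2 * m + 1\<close>.
\<close>

lemma colouring_square_product:
  fixes c :: "'i \<Rightarrow> 'a \<Rightarrow> int" and S :: "'i \<Rightarrow> int set" and m :: int
  assumes I: "finite I" and wf: "\<And>i. i \<in> I \<Longrightarrow> pair_graph (T i)"
    and S: "\<And>i. i \<in> I \<Longrightarrow> S i \<subseteq> {1..m}" "disjoint_family_on S I"
    and c: "\<And>i. i \<in> I \<Longrightarrow> difference_labelling (S i \<union> uminus ` S i) (T i) (pverts (T i)) (c i)"
  shows "colouring (graph_square (cartesian_product I T)) (\<lambda>v. (\<Sum>i\<in>I. c i (v i)) mod (2 * m + 1))"
proof -
  let ?G = "cartesian_product I T"
  define N where "N = 2 * m + 1"
  define f where "f = (\<lambda>v. \<Sum>i\<in>I. c i (v i))"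
  have f_upd: "f (v(i := x)) - f v = c i x - c i (v i)" if "i \<in> I" for v i x
  proof -
    have "(\<Sum>j\<in>I - {i}. c j ((v(i := x)) j)) = (\<Sum>j\<in>I - {i}. c j (v j))"
      by (intro sum.cong) auto
    then show ?thesis unfolding f_def using I that by (simp add: sum.remove[of I i])
  qed
  have vi: "v i \<in> pverts (T i)" if "v \<in> pverts ?G" "i \<in> I" for v i
    using that by (auto simp: cartesian_product_def)
  have step: "c i x - c i (v i) \<in> S i \<union> uminus ` S i"
    if "v \<in> pverts ?G" "i \<in> I" "x \<in> nbrs (T i) (v i)" for v i x
  proof -
    interpret pair_graph "T i" using wf that(2) .
    have "x \<in> pverts (T i)" using that(3) by (auto simp: nbrs_def dest: in_arcsD2)
    then show ?thesis using c[OF that(2)] vi[OF that(1,2)] that(3)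
      unfolding difference_labelling_def by blast
  qed
  have bound: "\<bar>s\<bar> \<in> S i" "1 \<le> \<bar>s\<bar>" "\<bar>s\<bar> \<le> m" if i: "i \<in> I" and s: "s \<in> S i \<union> uminus ` S i" for i s
  proof -
    obtain t where t: "t \<in> S i" "s = t \<or> s = - t" using s by auto
    then have "1 \<le> t" "t \<le> m" using S(1)[OF i] by auto
    then show "\<bar>s\<bar> \<in> S i" "1 \<le> \<bar>s\<bar>" "\<bar>s\<bar> \<le> m" using t by auto
  qed
  have separated: "a mod N \<noteq> b mod N" if "a \<noteq> b" "\<bar>a - b\<bar> < N" for a b :: int
  proof
    assume "a mod N = b mod N"
    then have "N dvd a - b" by (rule mod_eq_dvd_iff[THEN iffD1])
    then show False using that dvd_imp_le_int[of "a - b" N] by auto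
  qed
  have graph: "pair_graph ?G" using pair_graph_cartesian_product[OF I wf] .
  interpret P: pair_graph ?G by (rule graph)
  have adjacent: "f v mod N \<noteq> f w mod N" if vw: "(v, w) \<in> parcs ?G" for v w
  proof -
    have v: "v \<in> pverts ?G" using P.in_arcsD1[OF vw] .
    have "w \<in> nbrs ?G v" using vw by (simp add: nbrs_def)
    then obtain i x where i: "i \<in> I" "x \<in> nbrs (T i) (v i)" "w = v(i := x)"
      using nbrs_cartesian_product[OF wf v] by auto
    have "f w - f v \<in> S i \<union> uminus ` S i" using step[OF v i(1,2)] f_upd[OF i(1)] i(3) by simp
    from bound[OF i(1) this] have "f w mod N \<noteq> f v mod N"
      by (intro separated) (auto simp: N_def)
    then show ?thesis by simp
  qed
  have common: "f v mod N \<noteq> f w mod N"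
    if vu: "(v, u) \<in> parcs ?G" and wu: "(w, u) \<in> parcs ?G" and "v \<noteq> w" for u v w
  proof -
    have u: "u \<in> pverts ?G" using P.in_arcsD2[OF vu] .
    have "v \<in> nbrs ?G u" "w \<in> nbrs ?G u" using vu wu P.arcs_symmetric by (auto simp: nbrs_def)
    then obtain i x j y where i: "i \<in> I" "x \<in> nbrs (T i) (u i)" "v = u(i := x)"
      and j: "j \<in> I" "y \<in> nbrs (T j) (u j)" "w = u(j := y)"
      by (auto simp: nbrs_cartesian_product[OF wf u])
    define s where "s = f v - f u"
    define t where "t = f w - f u"
    have s: "s = c i x - c i (u i)" and t: "t = c j y - c j (u j)"
      unfolding s_def t_def i(3) j(3) using f_upd i(1) j(1) by auto
    have sb: "\<bar>s\<bar> \<in> S i" "\<bar>s\<bar> \<le> m" and tb: "\<bar>t\<bar> \<in> S j" "\<bar>t\<bar> \<le> m"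
      using bound[OF i(1)] step[OF u i(1,2)] bound[OF j(1)] step[OF u j(1,2)] unfolding s t by blast+
    have "s \<noteq> t"
    proof (cases "i = j")
      case True
      then have "x \<noteq> y" using \<open>v \<noteq> w\<close> i(3) j(3) by auto
      interpret pair_graph "T i" using wf i(1) .
      have "x \<in> pverts (T i)" "y \<in> pverts (T i)"
        using i(2) j(2) True in_arcsD2 unfolding nbrs_def by blast+
      then have "c i x \<noteq> c i y"
        using c[OF i(1)] vi[OF u i(1)] i(2) j(2) True \<open>x \<noteq> y\<close>
        unfolding difference_labelling_def by (auto dest: inj_onD)
      then show ?thesis using s t True by simp
    next
      case False
      then have "S i \<inter> S j = {}" using S(2) i(1) j(1) by (auto simp: disjoint_family_on_def)
      then show ?thesis using sb tb by auto
    qed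
    then show ?thesis using sb(2) tb(2) by (intro separated) (auto simp: s_def t_def N_def)
  qed
  show ?thesis
    using adjacent common unfolding colouring_def graph_square_def f_def N_def by auto
qed

theorem corollary1:
  fixes d :: nat and T :: "nat \<Rightarrow> 'a pair_pre_digraph"
  assumes "d \<ge> 1"
    and "\<And>i. i \<in> {1..d} \<Longrightarrow> undirected_tree (T i)"
    and "\<And>i. i \<in> {1..d} \<Longrightarrow> parcs (T i) \<noteq> {}"
    and "\<And>i. i \<in> {1..d} \<Longrightarrow> even (max_degree (T i))"
  shows "chromatic_number (graph_square (cartesian_product {1..d} T))
           = 1 + (\<Sum>i\<in>{1..d}. max_degree (T i))"
proof -
  let ?I = "{1..d}"
  let ?G = "cartesian_product ?I T"
  define k where "k = (\<lambda>i. max_degree (T i) div 2)"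
  define m where "m = (\<Sum>i\<in>?I. k i)"
  have deg: "max_degree (T i) = 2 * k i" if "i \<in> ?I" for i
    using assms(4)[OF that] by (simp add: k_def)
  then have n: "1 + (\<Sum>i\<in>?I. max_degree (T i)) = 2 * m + 1"
    by (simp add: m_def sum_distrib_left)
  have wf: "pair_graph (T i)" if "i \<in> ?I" for i
    using assms(2)[OF that] by (simp add: undirected_tree_def)
  have graph: "pair_graph ?G" using wf by (intro pair_graph_cartesian_product) auto
  interpret P: pair_graph ?G by (rule graph)

  \<comment> \<open>Upper bound: the modulus of the colouring is the number of colours.\<close>
  obtain S :: "nat \<Rightarrow> int set" where S: "\<And>i. i \<in> ?I \<Longrightarrow> S i \<subseteq> {1..int m}"
    "\<And>i. i \<in> ?I \<Longrightarrow> card (S i) = k i" "disjoint_family_on S ?I"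
    using disjoint_blocks[of ?I k] unfolding m_def by blast
  have "\<exists>c. difference_labelling (S i \<union> uminus ` S i) (T i) (pverts (T i)) c" if i: "i \<in> ?I" for i
  proof -
    have fin: "finite (S i)" using S(1)[OF i] finite_subset by blast
    have "x \<notin> S i" if x: "x \<in> uminus ` S i" for x
    proof -
      obtain y where "y \<in> S i" "x = - y" using x by blast
      then have "x < 0" using S(1)[OF i] by fastforce
      then show ?thesis using S(1)[OF i] by fastforce
    qed
    then have "S i \<inter> uminus ` S i = {}" by blast
    then have "card (S i \<union> uminus ` S i) = max_degree (T i)"
      using fin S(2)[OF i] deg[OF i] by (simp add: card_Un_disjoint card_image)
    moreover have "- x \<in> S i \<union> uminus ` S i" if "x \<in> S i \<union> uminus ` S i" for x
      using that by auto
    ultimately show ?thesis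
      using tree_difference_labelling[OF assms(2)[OF i]] fin by (metis finite_UnI finite_imageI)
  qed
  then obtain c where c:
    "\<And>i. i \<in> ?I \<Longrightarrow> difference_labelling (S i \<union> uminus ` S i) (T i) (pverts (T i)) (c i)"
    by metis
  let ?f = "\<lambda>v. (\<Sum>i\<in>?I. c i (v i)) mod (2 * int m + 1)"
  have col: "colouring (graph_square ?G) ?f"
    using wf S(1,3) c by (intro colouring_square_product) auto
  have "?f ` pverts (graph_square ?G) \<subseteq> {0..<2 * int m + 1}"
    using pos_mod_sign[of "2 * int m + 1"] pos_mod_bound[of "2 * int m + 1"]
    by (intro image_subsetI) (simp del: pos_mod_sign pos_mod_bound)
  then have few: "card (?f ` pverts (graph_square ?G)) \<le> 2 * m + 1"
    using card_mono[of "{0..<2 * int m + 1}" "?f ` pverts (graph_square ?G)"] by simp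

  \<comment> \<open>Lower bound: the closed neighbourhood of a tuple of vertices of maximum degree.\<close>
  have "\<exists>x. x \<in> pverts (T i) \<and> card (nbrs (T i) x) = max_degree (T i)" if i: "i \<in> ?I" for i
  proof -
    interpret pair_graph "T i" using wf i .
    have "pverts (T i) \<noteq> {}" using assms(2)[OF i]
      by (auto simp: undirected_tree_def connected_def strongly_connected_def)
    then show ?thesis using max_degree_attained by metis
  qed
  then obtain x where x: "\<And>i. i \<in> ?I \<Longrightarrow> x i \<in> pverts (T i)"
    "\<And>i. i \<in> ?I \<Longrightarrow> card (nbrs (T i) (x i)) = max_degree (T i)" by metis
  define v where "v = restrict x ?I"
  have v: "v \<in> pverts ?G" using x(1) by (auto simp: v_def cartesian_product_def)
  have "v \<notin> nbrs ?G v" using P.no_loops' by (auto simp: nbrs_def)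
  then have "card (insert v (nbrs ?G v)) = 1 + card (nbrs ?G v)"
    using P.finite_nbrs by simp
  also have "card (nbrs ?G v) = (\<Sum>i\<in>?I. card (nbrs (T i) (v i)))"
    using wf v by (intro card_nbrs_cartesian_product) auto
  also have "\<dots> = (\<Sum>i\<in>?I. max_degree (T i))"
    using x(2) by (intro sum.cong) (auto simp: v_def)
  finally have size: "card (insert v (nbrs ?G v)) = 1 + (\<Sum>i\<in>?I. max_degree (T i))" .
  have "insert v (nbrs ?G v) \<subseteq> pverts (graph_square ?G)"
    using v P.in_arcsD2 by (auto simp: nbrs_def graph_square_def)
  then show ?thesis
  proof (rule chromatic_number_eqI[rotated])
    show "finite (pverts (graph_square ?G))" using P.pair_finite_verts by (simp add: graph_square_def)
  qed (use size few n col closed_nbhd_clique_square[OF graph v] in auto)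
qed

end
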